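(* Let $X$ be an infinite-dimensional complex Banach space, and let $T\in\mathcal{L}(X)$. If $T$ fails to admit an almost-invariant halfspace of defect $\leq 1$, then there exists $e\in X$ such that $[T^n e]_{n=0}^\infty$ is finite-codimensional in $X$.
   Context: $\mathcal{L}(X)$ denotes the algebra of all continuous linear operators on $X$. For a sequence $(x_n)$ in $X$, $[x_n]$ denotes its closed linear span. A halfspace of $X$ is a closed subspace of $X$ with both infinite dimension and infinite codimension in $X$. A subspace $Y$ of $X$ is almost-invariant under $T$ if $TY\subseteq Y+E$ for some finite-dimensional subspace $E$ of $X$; the smallest possible dimension of such an $E$ is called the defect. *)

theory Defs
  imports "HOL-Analysis.Analysis" "HOL-Library.Set_Algebras"
begin

text \<open>The distribution has no complex normed spaces. A complex Banach space is a real Banach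
  space with a complex scalar multiplication that extends \<^const>\<open>scaleR\<close> and for which the
  norm is absolutely homogeneous over the complex numbers.\<close>

class complex_banach = banach +
  fixes scaleC :: "complex \<Rightarrow> 'a \<Rightarrow> 'a"  (infixr "*\<^sub>C" 75)
  assumes scaleC_add_right: "c *\<^sub>C (x + y) = c *\<^sub>C x + c *\<^sub>C y"
    and scaleC_add_left: "(c + d) *\<^sub>C x = c *\<^sub>C x + d *\<^sub>C x"
    and scaleC_scaleC: "c *\<^sub>C (d *\<^sub>C x) = (c * d) *\<^sub>C x"
    and scaleC_one: "1 *\<^sub>C x = x"
    and scaleC_of_real: "complex_of_real r *\<^sub>C x = r *\<^sub>R x"
    and norm_scaleC: "norm (c *\<^sub>C x) = cmod c * norm x"

global_interpretation complex_vector: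
  vector_space "scaleC :: complex \<Rightarrow> 'a \<Rightarrow> 'a::complex_banach"
  defines csubspace = complex_vector.subspace
    and cspan = complex_vector.span
    and cdependent = complex_vector.dependent
    and cdim = complex_vector.dim
  by unfold_locales
    (simp_all add: scaleC_add_right scaleC_add_left scaleC_scaleC scaleC_one)

definition closed_cspan :: "'a::complex_banach set \<Rightarrow> 'a set"
  where "closed_cspan S = closure (cspan S)"

text \<open>The predicate below is needed because \<^const>\<open>cdim\<close> returns 0 on infinite-dimensional
  subspaces.\<close>

definition finite_cdim :: "'a::complex_banach set \<Rightarrow> bool"
  where "finite_cdim Y \<longleftrightarrow> (\<exists>B. finite B \<and> cspan B = Y)"

text \<open>For a subspace \<open>Y\<close> of the whole space \<open>X\<close>, this says that the quotient \<open>X/Y\<close> is spanned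
  by the classes of finitely many vectors, i.e. that \<open>X/Y\<close> is finite-dimensional.\<close>

definition finite_ccodim :: "'a::complex_banach set \<Rightarrow> bool"
  where "finite_ccodim Y \<longleftrightarrow> (\<exists>B. finite B \<and> (\<forall>x. \<exists>v\<in>cspan B. x - v \<in> Y))"

definition halfspace :: "'a::complex_banach set \<Rightarrow> bool"
  where "halfspace Y \<longleftrightarrow>
    csubspace Y \<and> closed Y \<and> \<not> finite_cdim Y \<and> \<not> finite_ccodim Y"

definition almost_invariant :: "('a \<Rightarrow> 'a) \<Rightarrow> 'a::complex_banach set \<Rightarrow> bool"
  where "almost_invariant T Y \<longleftrightarrow>
    (\<exists>E. csubspace E \<and> finite_cdim E \<and> T ` Y \<subseteq> Y + E)"

text \<open>Only meaningful when \<open>Y\<close> is almost-invariant under \<open>T\<close>.\<close>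

definition defect :: "('a \<Rightarrow> 'a) \<Rightarrow> 'a::complex_banach set \<Rightarrow> nat"
  where "defect T Y =
    (LEAST d. \<exists>E. csubspace E \<and> finite_cdim E \<and> cdim E = d \<and> T ` Y \<subseteq> Y + E)"

end

theory Submission
  imports Defs "HOL-Computational_Algebra.Fundamental_Theorem_Algebra"
begin

text \<open>The closed span of an orbit \<open>e, T e, T\<^sup>2 e, \<dots>\<close> is invariant under \<open>T\<close>. Suppose that none of
  these spans has finite codimension. An infinite-dimensional one would then be an invariant
  halfspace, which has defect 0; so under the hypothesis every orbit spans a finite-dimensional
  space, that is, every vector is annihilated by a nonzero polynomial in \<open>T\<close>.

  Baire's theorem makes this uniform (\<open>uniform_degree_bound\<close>): there is one \<open>N\<close> such that each
  vector is annihilated by a nonzero polynomial of degree at most \<open>N\<close>. Then \<open>T\<close> has at most \<open>N\<close>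
  eigenvalues, and \<open>(\<Prod>\<lambda>. T - \<lambda>)\<^sup>N = 0\<close> where \<open>\<lambda>\<close> runs over them. As \<open>X\<close> is infinite-dimensional,
  one factor has an infinite-dimensional kernel (\<open>exists_infinite_dimensional_eigenspace\<close>). Every
  subspace of this eigenspace is invariant, so it suffices to find a halfspace in it, which
  contradicts the hypothesis.

  That every infinite-dimensional closed subspace contains a halfspace (\<open>exists_halfspace_subset\<close>)
  needs a biorthogonal sequence, hence continuous functionals, hence a form of the Hahn-Banach
  theorem; the latter is obtained from the fact that minimal sublinear functionals are linear.\<close>

section \<open>Sublinear functionals and the Hahn-Banach theorem\<close>

text \<open>Positive homogeneity is required only as an inequality, which is easier to verify;
  equality follows (\<open>sublinear_scaleR\<close>).\<close>

definition sublinear :: "('a::real_vector \<Rightarrow> real) \<Rightarrow> bool"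
  where "sublinear q \<longleftrightarrow>
    (\<forall>x y. q (x + y) \<le> q x + q y) \<and> (\<forall>t x. 0 \<le> t \<longrightarrow> q (t *\<^sub>R x) \<le> t * q x)"

lemma sublinearI:
  assumes "\<And>x y. q (x + y) \<le> q x + q y" and "q 0 \<le> 0"
    and "\<And>t x. 0 < t \<Longrightarrow> q (t *\<^sub>R x) \<le> t * q x"
  shows "sublinear q"
  unfolding sublinear_def
proof (intro conjI allI impI)
  fix t :: real and x assume "0 \<le> t"
  then show "q (t *\<^sub>R x) \<le> t * q x"
    using assms(2) assms(3)[of t x] by (cases "t = 0") auto
qed (rule assms)

lemma sublinear_add: "sublinear q \<Longrightarrow> q (x + y) \<le> q x + q y"
  by (simp add: sublinear_def)

lemma sublinear_zero: "sublinear q \<Longrightarrow> q 0 = 0"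
  unfolding sublinear_def by (metis add_le_same_cancel1 antisym_conv le_add_same_cancel1
      mult_zero_left order_refl scaleR_zero_left add_0)

lemma sublinear_scaleR:
  assumes "sublinear q" "0 \<le> t"
  shows "q (t *\<^sub>R x) = t * q x"
proof (cases "t = 0")
  case True
  then show ?thesis using sublinear_zero[OF assms(1)] by simp
next
  case False
  with assms have t: "0 < t" by simp
  have "q ((1 / t) *\<^sub>R (t *\<^sub>R x)) \<le> (1 / t) * q (t *\<^sub>R x)"
    using assms t unfolding sublinear_def by (meson divide_nonneg_pos zero_le_one)
  then have "t * q x \<le> q (t *\<^sub>R x)"
    using t by (simp add: field_simps)
  then show ?thesis using assms by (simp add: sublinear_def antisym)
qed

lemma sublinear_lower:
  assumes "sublinear q"
  shows "- q (- x) \<le> q x"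
  using sublinear_add[OF assms, of x "- x"] sublinear_zero[OF assms] by simp

text \<open>The values at \<open>x\<close> are bounded below by \<open>- p (- x)\<close>, so the infimum is a real number. The chain
  condition gives subadditivity: the bounds obtained from \<open>q\<close> at \<open>x\<close> and from \<open>r\<close> at \<open>y\<close> both
  hold for the smaller of the two.\<close>

lemma sublinear_INF_chain:
  fixes C :: "('a::real_vector \<Rightarrow> real) set"
  assumes "C \<noteq> {}" and sub: "\<And>q. q \<in> C \<Longrightarrow> sublinear q" and le: "\<And>q. q \<in> C \<Longrightarrow> q \<le> p"
    and chain: "\<And>q r. q \<in> C \<Longrightarrow> r \<in> C \<Longrightarrow> q \<le> r \<or> r \<le> q"
  shows "sublinear (\<lambda>x. INF q\<in>C. q x)" and "\<And>q x. q \<in> C \<Longrightarrow> (INF q\<in>C. q x) \<le> q x"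
proof -
  have bdd: "bdd_below ((\<lambda>q. q x) ` C)" for x
  proof (rule bdd_belowI2)
    fix q assume "q \<in> C"
    then show "- p (- x) \<le> q x"
      using sublinear_lower[OF sub, of q x] le[of q] by (force simp: le_fun_def dest: spec[of _ "- x"])
  qed
  show low: "\<And>q x. q \<in> C \<Longrightarrow> (INF q\<in>C. q x) \<le> q x"
    using bdd by (rule cINF_lower)
  show "sublinear (\<lambda>x. INF q\<in>C. q x)"
  proof (rule sublinearI)
    fix x y
    have *: "(INF q\<in>C. q (x + y)) \<le> q x + r y" if qr: "q \<in> C" "r \<in> C" for q r
    proof -
      obtain m where m: "m \<in> C" "m \<le> q" "m \<le> r"
        using chain[OF qr] qr by blast
      have "(INF q\<in>C. q (x + y)) \<le> m (x + y)" by (rule low[OF m(1)])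
      also have "\<dots> \<le> m x + m y" by (rule sublinear_add[OF sub[OF m(1)]])
      also have "\<dots> \<le> q x + r y" using m by (simp add: le_fun_def add_mono)
      finally show ?thesis .
    qed
    have "(INF q\<in>C. q (x + y)) - q x \<le> (INF r\<in>C. r y)" if "q \<in> C" for q
      by (rule cINF_greatest[OF assms(1)]) (use *[OF that] in \<open>simp add: algebra_simps\<close>)
    then have "(INF q\<in>C. q (x + y)) - (INF r\<in>C. r y) \<le> (INF q\<in>C. q x)"
      by (intro cINF_greatest[OF assms(1)]) (simp add: algebra_simps)
    then show "(INF q\<in>C. q (x + y)) \<le> (INF q\<in>C. q x) + (INF q\<in>C. q y)" by simp
  next
    obtain q where q: "q \<in> C" using assms(1) by blast
    then show "(INF q\<in>C. q 0) \<le> 0"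
      using low[OF q, of 0] sublinear_zero[OF sub[OF q]] by simp
  next
    fix t :: real and x assume t: "0 < t"
    have "(INF q\<in>C. q (t *\<^sub>R x)) / t \<le> (INF q\<in>C. q x)"
    proof (rule cINF_greatest[OF assms(1)])
      fix q assume q: "q \<in> C"
      then show "(INF q\<in>C. q (t *\<^sub>R x)) / t \<le> q x"
        using low[OF q, of "t *\<^sub>R x"] sublinear_scaleR[OF sub[OF q], of t x] t
        by (simp add: field_simps)
    qed
    then show "(INF q\<in>C. q (t *\<^sub>R x)) \<le> t * (INF q\<in>C. q x)"
      using t by (simp add: field_simps)
  qed
qed

text \<open>This is the largest sublinear functional below \<open>q\<close> whose value at \<open>- a\<close> is at most \<open>- q a\<close>.
  A linear functional below it therefore takes a value of at least \<open>q a\<close> at \<open>a\<close>.\<close>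

definition lowered_at :: "'a \<Rightarrow> ('a::real_vector \<Rightarrow> real) \<Rightarrow> 'a \<Rightarrow> real"
  where "lowered_at a q x = (INF t\<in>{0..}. q (x + t *\<^sub>R a) - t * q a)"

lemma lowered_at:
  assumes q: "sublinear q"
  shows lowered_at_le: "0 \<le> t \<Longrightarrow> lowered_at a q x \<le> q (x + t *\<^sub>R a) - t * q a"
    and sublinear_lowered_at: "sublinear (lowered_at a q)"
proof -
  have bdd: "bdd_below ((\<lambda>t. q (x + t *\<^sub>R a) - t * q a) ` {0..})" for x
  proof (rule bdd_belowI2)
    fix t :: real assume "t \<in> {0..}"
    then show "- q (- x) \<le> q (x + t *\<^sub>R a) - t * q a"
      using sublinear_add[OF q, of "- x" "x + t *\<^sub>R a"] sublinear_scaleR[OF q, of t a] by simp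
  qed
  show low: "lowered_at a q x \<le> q (x + t *\<^sub>R a) - t * q a" if "0 \<le> t" for t x
    unfolding lowered_at_def by (rule cINF_lower[OF bdd]) (use that in simp)
  have great: "u \<le> lowered_at a q x"
    if "\<And>t. 0 \<le> t \<Longrightarrow> u \<le> q (x + t *\<^sub>R a) - t * q a" for u x
    unfolding lowered_at_def by (rule cINF_greatest) (use that in auto)
  show "sublinear (lowered_at a q)"
  proof (rule sublinearI)
    fix x y
    have *: "lowered_at a q (x + y) \<le> (q (x + s *\<^sub>R a) - s * q a) + (q (y + t *\<^sub>R a) - t * q a)"
      if "0 \<le> s" "0 \<le> t" for s t
      using low[of "s + t" "x + y"] that
        sublinear_add[OF q, of "x + s *\<^sub>R a" "y + t *\<^sub>R a"]
      by (simp add: algebra_simps)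
    have "lowered_at a q (x + y) - (q (x + s *\<^sub>R a) - s * q a) \<le> lowered_at a q y"
      if "0 \<le> s" for s
      by (rule great) (use *[OF that] in \<open>simp add: algebra_simps\<close>)
    then have "lowered_at a q (x + y) - lowered_at a q y \<le> lowered_at a q x"
      by (intro great) (simp add: algebra_simps)
    then show "lowered_at a q (x + y) \<le> lowered_at a q x + lowered_at a q y" by simp
  next
    show "lowered_at a q 0 \<le> 0" using low[of 0 0] sublinear_zero[OF q] by simp
  next
    fix t :: real and x assume t: "0 < t"
    have "lowered_at a q (t *\<^sub>R x) / t \<le> lowered_at a q x"
    proof (rule great)
      fix s :: real assume s: "0 \<le> s"
      have "q (t *\<^sub>R x + (t * s) *\<^sub>R a) = t * q (x + s *\<^sub>R a)"
        using sublinear_scaleR[OF q, of t "x + s *\<^sub>R a"] t by (simp add: algebra_simps)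
      then have "lowered_at a q (t *\<^sub>R x) \<le> t * (q (x + s *\<^sub>R a) - s * q a)"
        using low[of "t * s" "t *\<^sub>R x"] s t by (simp add: algebra_simps)
      then show "lowered_at a q (t *\<^sub>R x) / t \<le> q (x + s *\<^sub>R a) - s * q a"
        using t by (simp add: field_simps)
    qed
    then show "lowered_at a q (t *\<^sub>R x) \<le> t * lowered_at a q x"
      using t by (simp add: field_simps)
  qed
qed

text \<open>Minimality forces \<open>lowered_at a q = q\<close> for every \<open>a\<close>; at \<open>t = 1\<close> this is superadditivity of \<open>q\<close>.\<close>

lemma minimal_sublinear_linear:
  assumes q: "sublinear q" and min: "\<And>r. sublinear r \<Longrightarrow> r \<le> q \<Longrightarrow> r = q"
  shows "linear q"
proof -
  have add: "q (x + a) = q x + q a" for x a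
  proof -
    have "lowered_at a q \<le> q"
      using lowered_at_le[OF q, of 0 a] by (simp add: le_fun_def)
    then have "lowered_at a q = q"
      by (rule min[OF sublinear_lowered_at[OF q]])
    then have "q x \<le> q (x + a) - q a"
      using lowered_at_le[OF q, of 1 a x] by simp
    with sublinear_add[OF q, of x a] show ?thesis by simp
  qed
  have neg: "q (- x) = - q x" for x
    using add[of x "- x"] sublinear_zero[OF q] by simp
  have "q (t *\<^sub>R x) = t *\<^sub>R q x" for t x
  proof (cases "0 \<le> t")
    case False
    then show ?thesis
      using sublinear_scaleR[OF q, of "- t" x] neg[of "t *\<^sub>R x"] by simp
  qed (simp add: sublinear_scaleR[OF q])
  with add show ?thesis by (intro linearI) auto
qed

text \<open>Zorn's lemma, applied to the reversed pointwise order, yields a minimal sublinear functional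
  below \<open>p\<close>.\<close>

lemma linear_below_sublinear:
  fixes p :: "'a::real_vector \<Rightarrow> real"
  assumes p: "sublinear p"
  shows "\<exists>f. linear f \<and> f \<le> p"
proof -
  define A where "A = {q. sublinear q \<and> q \<le> p}"
  define P where "P = (\<lambda>(q::'a \<Rightarrow> real) r. r \<le> q)"
  have "\<exists>m\<in>A. \<forall>a\<in>A. P m a \<longrightarrow> a = m"
  proof (rule predicate_Zorn)
    show "partial_order_on A (relation_of P A)"
      by (rule partial_order_on_relation_ofI) (auto simp: P_def)
    fix C assume "C \<in> Chains (relation_of P A)"
    then have C: "C \<subseteq> A" "\<And>q r. q \<in> C \<Longrightarrow> r \<in> C \<Longrightarrow> q \<le> r \<or> r \<le> q"
      by (auto simp: Chains_def relation_of_def P_def)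
    show "\<exists>u\<in>A. \<forall>a\<in>C. P a u"
    proof (cases "C = {}")
      case True
      then show ?thesis using p by (auto simp: A_def)
    next
      case False
      have *: "\<And>q. q \<in> C \<Longrightarrow> sublinear q" "\<And>q. q \<in> C \<Longrightarrow> q \<le> p"
        using C(1) by (auto simp: A_def)
      have inf: "sublinear (\<lambda>x. INF q\<in>C. q x)" "\<And>q x. q \<in> C \<Longrightarrow> (INF q\<in>C. q x) \<le> q x"
        by (rule sublinear_INF_chain[where p = p]; use False * C(2) in blast)+
      obtain q where q: "q \<in> C" using False by blast
      have "(\<lambda>x. INF q\<in>C. q x) \<le> q"
        using inf(2)[OF q] by (simp add: le_fun_def)
      also have "q \<le> p" using *(2)[OF q] .
      finally have "(\<lambda>x. INF q\<in>C. q x) \<in> A" using inf(1) by (simp add: A_def)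
      with inf(2) show ?thesis
        by (intro bexI[of _ "\<lambda>x. INF q\<in>C. q x"]) (auto simp: P_def le_fun_def)
    qed
  qed
  then obtain m where m: "sublinear m" "m \<le> p" and "\<And>q. sublinear q \<Longrightarrow> q \<le> p \<Longrightarrow> q \<le> m \<Longrightarrow> q = m"
    by (auto simp: A_def P_def)
  then have "linear m"
    by (intro minimal_sublinear_linear) (auto intro: order_trans)
  with m show ?thesis by blast
qed

text \<open>A linear functional below the norm lowered at \<open>a\<close> is bounded by the norm and at least \<open>norm a\<close>
  at \<open>a\<close>.\<close>

lemma real_functional_positive_at:
  fixes a :: "'a::real_normed_vector"
  assumes "a \<noteq> 0"
  shows "\<exists>f. linear f \<and> (\<forall>x. \<bar>f x\<bar> \<le> norm x) \<and> 0 < f a"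
proof -
  have n: "sublinear (norm :: 'a \<Rightarrow> real)"
    by (rule sublinearI) (auto intro: norm_triangle_ineq)
  obtain f where f: "linear f" "f \<le> lowered_at a norm"
    using linear_below_sublinear[OF sublinear_lowered_at[OF n, of a]] by blast
  have f': "f x \<le> norm (x + t *\<^sub>R a) - t * norm a" if "0 \<le> t" for x t
    using f(2) lowered_at_le[OF n that, of a x] by (force simp: le_fun_def intro: order_trans)
  have "\<bar>f x\<bar> \<le> norm x" for x
    using f'[of 0 x] f'[of 0 "- x"] linear_neg[OF f(1), of x] by auto
  moreover have "norm a \<le> f a"
    using f'[of 1 "- a"] linear_neg[OF f(1), of a] by simp
  ultimately show ?thesis using f(1) assms by (metis less_le_trans zero_less_norm_iff)
qed

section \<open>Complex functionals and halfspaces\<close>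

lemma bounded_bilinear_scaleC:
  "bounded_bilinear (scaleC :: complex \<Rightarrow> 'a::complex_banach \<Rightarrow> 'a)"
proof
  fix r :: real and c :: complex and x y :: 'a
  have r: "r *\<^sub>R x = complex_of_real r *\<^sub>C x" for x :: 'a by (simp add: scaleC_of_real)
  show "(r *\<^sub>R c) *\<^sub>C x = r *\<^sub>R (c *\<^sub>C x)"
    by (simp add: r scaleC_scaleC scaleR_conv_of_real)
  show "c *\<^sub>C (r *\<^sub>R x) = r *\<^sub>R (c *\<^sub>C x)"
    by (simp add: r scaleC_scaleC mult.commute)
  show "\<exists>K. \<forall>c (x::'a). norm (c *\<^sub>C x) \<le> norm c * norm x * K"
    by (rule exI[of _ 1]) (simp add: norm_scaleC)
qed (simp_all add: scaleC_add_left scaleC_add_right)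

lemmas continuous_on_scaleC [continuous_intros] =
  bounded_bilinear.continuous_on[OF bounded_bilinear_scaleC]

text \<open>The topological dual, i.e. the continuous complex-linear functionals.\<close>

definition cdual :: "('a::complex_banach \<Rightarrow> complex) set"
  where "cdual = {f. (\<forall>x y. f (x + y) = f x + f y) \<and> (\<forall>c x. f (c *\<^sub>C x) = c * f x) \<and>
    continuous_on UNIV f}"

lemma cdual_add: "f \<in> cdual \<Longrightarrow> f (x + y) = f x + f y"
  and cdual_scaleC: "f \<in> cdual \<Longrightarrow> f (c *\<^sub>C x) = c * f x"
  and cdual_continuous: "f \<in> cdual \<Longrightarrow> continuous_on UNIV f"
  by (simp_all add: cdual_def)

lemma cdual_zero: "f \<in> cdual \<Longrightarrow> f 0 = 0"
  using cdual_add[of f 0 0] by simp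

lemma cdual_diff: "f \<in> cdual \<Longrightarrow> f (x - y) = f x - f y"
  using cdual_add[of f "x - y" y] by simp

lemma cdual_sum: "f \<in> cdual \<Longrightarrow> f (sum g A) = (\<Sum>i\<in>A. f (g i))"
  by (induction A rule: infinite_finite_induct) (simp_all add: cdual_zero cdual_add)

text \<open>A real-linear functional \<open>g\<close> is the real part of the complex-linear functional
  \<open>g x - \<i> g (\<i> x)\<close>.\<close>

lemma exists_cdual_nonzero:
  fixes a :: "'a::complex_banach"
  assumes "a \<noteq> 0"
  shows "\<exists>f\<in>cdual. f a \<noteq> 0"
proof -
  obtain g where g: "linear g" "\<And>x. \<bar>g x\<bar> \<le> norm x" "0 < g a"
    using real_functional_positive_at[OF assms] by blast
  define f where "f x = Complex (g x) (- g (\<i> *\<^sub>C x))" for x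
  have "bounded_linear g"
    by (rule bounded_linear_intro[of _ 1])
      (use g in \<open>auto simp: linear_add linear_scale\<close>)
  then have cont: "continuous_on S g" for S
    by (rule linear_continuous_on)
  have "continuous_on UNIV (\<lambda>x. complex_of_real (g x) - \<i> * complex_of_real (g (\<i> *\<^sub>C x)))"
    by (intro continuous_intros cont continuous_on_compose2[OF cont]) auto
  moreover have "f = (\<lambda>x. complex_of_real (g x) - \<i> * complex_of_real (g (\<i> *\<^sub>C x)))"
    by (auto simp: f_def complex_eq_iff)
  ultimately have "continuous_on UNIV f" by simp
  moreover have add: "f (x + y) = f x + f y" for x y
    using g(1) by (simp add: f_def complex_eq_iff linear_add scaleC_add_right)
  moreover have "f (c *\<^sub>C x) = c * f x" for c x
  proof -
    have re: "f (r *\<^sub>R x) = r *\<^sub>R f x" for r x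
      using g(1) by (simp add: f_def complex_eq_iff linear_scale
          bounded_bilinear.scaleR_right[OF bounded_bilinear_scaleC])
    have "g (- x) = - g x" using g(1) by (rule linear_neg)
    moreover have "\<i> *\<^sub>C \<i> *\<^sub>C x = - x"
      using scaleC_of_real[of "-1" x] by (simp add: scaleC_scaleC)
    ultimately have im: "f (\<i> *\<^sub>C x) = \<i> * f x"
      by (simp add: f_def complex_eq_iff)
    have "c *\<^sub>C x = Re c *\<^sub>R x + Im c *\<^sub>R (\<i> *\<^sub>C x)"
    proof -
      have "c = complex_of_real (Re c) + complex_of_real (Im c) * \<i>"
        by (simp add: complex_eq_iff)
      then have "c *\<^sub>C x = (complex_of_real (Re c) + complex_of_real (Im c) * \<i>) *\<^sub>C x"
        by simp
      then show ?thesis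
        by (simp only: scaleC_add_left scaleC_of_real flip: scaleC_scaleC)
    qed
    then have "f (c *\<^sub>C x) = Re c *\<^sub>R f x + Im c *\<^sub>R (\<i> * f x)"
      by (simp only: add re im)
    also have "\<dots> = c * f x"
      by (simp add: complex_eq_iff)
    finally show ?thesis .
  qed
  moreover have "f a \<noteq> 0" using g(3) by (simp add: f_def complex_eq_iff)
  ultimately show ?thesis unfolding cdual_def by blast
qed

text \<open>For a subspace the spanning set may be taken outside \<open>Y\<close>: a maximal independent subset of \<open>Y\<close>
  is finite as soon as \<open>Y\<close> lies in a finitely generated space.\<close>

lemma finite_cdim_iff:
  assumes "csubspace Y"
  shows "finite_cdim Y \<longleftrightarrow> (\<exists>B. finite B \<and> Y \<subseteq> cspan B)"
proof
  assume "\<exists>B. finite B \<and> Y \<subseteq> cspan B"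
  then obtain B where B: "finite B" "Y \<subseteq> cspan B" by blast
  obtain C where C: "C \<subseteq> Y" "\<not> cdependent C" "Y \<subseteq> cspan C"
    by (rule complex_vector.maximal_independent_subset)
  then have "finite C"
    using complex_vector.independent_span_bound[OF B(1) C(2)] B(2) by blast
  moreover have "cspan C = Y"
    using C complex_vector.span_minimal[OF C(1) assms] by blast
  ultimately show "finite_cdim Y" unfolding finite_cdim_def by blast
qed (auto simp: finite_cdim_def)

text \<open>Biorthogonality makes any \<open>card B + 1\<close> of the vectors \<open>v j\<close> independent, too many for the span
  of \<open>B\<close>.\<close>

lemma biorthogonal_not_in_finite_span:
  fixes v :: "nat \<Rightarrow> 'a::complex_banach"
  assumes f: "\<And>i. f i \<in> cdual" and bi: "\<And>i j. f i (v j) = (if i = j then 1 else 0)"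
    and B: "finite B" and v: "\<And>j. v j \<in> cspan B"
  shows False
proof -
  define n where "n = card B"
  have inj: "inj v"
    by (rule injI) (metis bi zero_neq_one)
  have ind: "\<not> cdependent (v ` {..n})"
  proof
    assume "cdependent (v ` {..n})"
    then obtain u where u: "\<exists>w\<in>v ` {..n}. u w \<noteq> 0" "(\<Sum>w\<in>v ` {..n}. u w *\<^sub>C w) = 0"
      by (auto simp: complex_vector.dependent_finite)
    then obtain i where i: "i \<le> n" "u (v i) \<noteq> 0" by auto
    have "0 = f i (\<Sum>j\<le>n. u (v j) *\<^sub>C v j)"
      using u(2) inj by (simp add: sum.reindex inj_on_subset cdual_zero[OF f])
    also have "\<dots> = (\<Sum>j\<le>n. u (v j) * (if i = j then 1 else 0))"
      by (simp add: cdual_sum[OF f] cdual_scaleC[OF f] bi)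
    also have "\<dots> = u (v i)"
      using i(1) by (simp add: if_distrib cong: if_cong)
    finally show False using i by simp
  qed
  have "card (v ` {..n}) \<le> card B"
    using complex_vector.independent_span_bound[OF B ind] v by blast
  then show False
    using inj by (simp add: card_image inj_on_subset n_def)
qed

text \<open>The pairs are chosen recursively. If \<open>n\<close> pairs are given, then \<open>Z\<close> contains a nonzero vector \<open>a\<close>
  on which all \<open>n\<close> functionals vanish; otherwise every \<open>x\<close> in \<open>Z\<close> would equal its biorthogonal
  expansion \<open>\<Sum>m<n. f m x *\<^sub>C z m\<close>, and \<open>Z\<close> would be finite-dimensional. A functional \<open>g\<close> with
  \<open>g a \<noteq> 0\<close> is then corrected by a combination of the earlier functionals, all of which vanish
  at \<open>a\<close>, so that it vanishes at the earlier vectors.\<close>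

lemma biorthogonal_sequence:
  fixes Z :: "'a::complex_banach set"
  assumes Z: "csubspace Z" "\<not> finite_cdim Z"
  obtains z :: "nat \<Rightarrow> 'a" and f where "\<And>n. z n \<in> Z" "\<And>n. f n \<in> cdual"
    "\<And>i j. f i (z j) = (if i = j then 1 else (0::complex))"
proof -
  define P where "P h n zf \<longleftrightarrow> fst zf \<in> Z \<and> snd zf \<in> cdual \<and> snd zf (fst zf) = (1::complex) \<and>
     (\<forall>m<n. snd (h m) (fst zf) = 0 \<and> snd zf (fst (h m)) = 0)"
    for h :: "nat \<Rightarrow> 'a \<times> ('a \<Rightarrow> complex)" and n zf
  have "\<exists>h. \<forall>n. P h n (h n)"
  proof (rule dependent_wellorder_choice)
    fix zf and h h' :: "nat \<Rightarrow> 'a \<times> ('a \<Rightarrow> complex)" and n :: nat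
    assume "\<And>m. m < n \<Longrightarrow> h m = h' m"
    then show "P h n zf = P h' n zf" by (simp add: P_def)
  next
    fix n and h :: "nat \<Rightarrow> 'a \<times> ('a \<Rightarrow> complex)" assume "\<And>m. m < n \<Longrightarrow> P h m (h m)"
    then have h: "fst (h m) \<in> Z" "snd (h m) \<in> cdual" "snd (h m) (fst (h m)) = 1"
      "\<And>k. k < m \<Longrightarrow> snd (h k) (fst (h m)) = 0 \<and> snd (h m) (fst (h k)) = 0" if "m < n" for m
      using that by (auto simp: P_def)
    have bi: "snd (h i) (fst (h j)) = (if i = j then 1 else 0)" if "i < n" "j < n" for i j
      using h(3)[OF that(1)] h(4)[OF that(1), of j] h(4)[OF that(2), of i]
      by (cases i j rule: linorder_cases) auto
    have "\<exists>a\<in>Z. a \<noteq> 0 \<and> (\<forall>m<n. snd (h m) a = 0)"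
    proof (rule ccontr)
      assume "\<not> ?thesis"
      then have none: "a = 0" if "a \<in> Z" "\<And>m. m < n \<Longrightarrow> snd (h m) a = 0" for a
        using that by blast
      have "Z \<subseteq> cspan ((\<lambda>m. fst (h m)) ` {..<n})"
      proof
        fix x assume x: "x \<in> Z"
        define y where "y = (\<Sum>m<n. snd (h m) x *\<^sub>C fst (h m))"
        have "y \<in> Z" unfolding y_def
          using h(1) by (intro complex_vector.subspace_sum complex_vector.subspace_scale Z) auto
        then have "x - y \<in> Z" using x Z(1) by (simp add: complex_vector.subspace_diff)
        moreover have "snd (h m) (x - y) = 0" if "m < n" for m
        proof -
          have "snd (h m) y = (\<Sum>k<n. snd (h k) x * (if m = k then 1 else 0))"
            unfolding y_def using h(2)[OF that] bi[OF that]
            by (simp add: cdual_sum cdual_scaleC)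
          also have "\<dots> = snd (h m) x"
            using that by (simp add: if_distrib cong: if_cong)
          finally show ?thesis using h(2)[OF that] by (simp add: cdual_diff)
        qed
        ultimately have "x = y" using none by fastforce
        moreover have "y \<in> cspan ((\<lambda>m. fst (h m)) ` {..<n})"
          unfolding y_def
          by (intro complex_vector.span_sum complex_vector.span_scale complex_vector.span_base) simp
        ultimately show "x \<in> cspan ((\<lambda>m. fst (h m)) ` {..<n})" by simp
      qed
      then show False using Z finite_cdim_iff by blast
    qed
    then obtain a where a: "a \<in> Z" "a \<noteq> 0" "\<And>m. m < n \<Longrightarrow> snd (h m) a = 0" by blast
    obtain g where g: "g \<in> cdual" "g a \<noteq> 0" using exists_cdual_nonzero[OF a(2)] by blast
    define f where "f x = (g x - (\<Sum>m<n. g (fst (h m)) * snd (h m) x)) / g a" for x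
    have "f \<in> cdual"
      unfolding cdual_def
    proof (intro CollectI conjI allI)
      show "f (x + y) = f x + f y" for x y
        using g h(2)
        by (simp add: f_def cdual_add sum.distrib distrib_left diff_divide_distrib add_divide_distrib)
      show "f (c *\<^sub>C x) = c * f x" for c x
      proof -
        have "(\<Sum>m<n. g (fst (h m)) * snd (h m) (c *\<^sub>C x)) =
            c * (\<Sum>m<n. g (fst (h m)) * snd (h m) x)"
          unfolding sum_distrib_left
          by (rule sum.cong) (use h(2) in \<open>simp_all add: cdual_scaleC\<close>)
        then show ?thesis
          using g by (simp add: f_def cdual_scaleC algebra_simps)
      qed
      show "continuous_on UNIV f"
        unfolding f_def
        by (intro continuous_intros cdual_continuous[OF g(1)])
          (use g h(2) in \<open>auto intro: cdual_continuous\<close>)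
    qed
    moreover have "f a = 1" using g a by (simp add: f_def)
    moreover have "f (fst (h m)) = 0" if "m < n" for m
    proof -
      have "(\<Sum>k<n. g (fst (h k)) * snd (h k) (fst (h m))) =
        (\<Sum>k<n. g (fst (h k)) * (if k = m then 1 else 0))"
        using bi that by simp
      also have "\<dots> = g (fst (h m))" using that by (simp add: if_distrib cong: if_cong)
      finally show ?thesis by (simp add: f_def)
    qed
    ultimately have "P h n (a, f)" using a by (simp add: P_def)
    then show "\<exists>r. P h n r" by blast
  qed
  then obtain h where h: "\<And>n. P h n (h n)" by blast
  show thesis
  proof (rule that[of "\<lambda>n. fst (h n)" "\<lambda>n. snd (h n)"])
    show "snd (h i) (fst (h j)) = (if i = j then 1 else 0)" for i j
      using h[of i] h[of j] unfolding P_def by (cases i j rule: linorder_cases) auto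
  qed (use h in \<open>auto simp: P_def\<close>)
qed

text \<open>The subspace of \<open>Z\<close> where all odd-indexed functionals of a biorthogonal sequence vanish contains
  the even-indexed vectors, so it is infinite-dimensional; the odd-indexed vectors are independent
  modulo it, so it has infinite codimension. It is closed as an intersection of kernels.\<close>

lemma exists_halfspace_subset:
  fixes Z :: "'a::complex_banach set"
  assumes Z: "csubspace Z" "closed Z" "\<not> finite_cdim Z"
  shows "\<exists>Y\<subseteq>Z. halfspace Y"
proof -
  obtain z :: "nat \<Rightarrow> 'a" and f where z: "\<And>n. z n \<in> Z" and f: "\<And>n. f n \<in> cdual"
    and bi: "\<And>i j. f i (z j) = (if i = j then 1 else (0::complex))"
    using biorthogonal_sequence[OF Z(1,3)] by blast
  define Y where "Y = Z \<inter> (\<Inter>n. {x. f (2 * n + 1) x = 0})"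
  have sub: "csubspace Y"
    using Z(1) f unfolding Y_def complex_vector.subspace_def
    by (auto simp: cdual_add cdual_scaleC cdual_zero)
  have "closed {x. f n x = 0}" for n
    using continuous_closed_preimage[OF cdual_continuous[OF f[of n]] closed_UNIV, of "{0}"]
    by (simp add: vimage_def)
  then have "closed Y" unfolding Y_def using Z(2) by (intro closed_Int closed_INT) auto
  moreover have "\<not> finite_cdim Y"
  proof
    assume "finite_cdim Y"
    then obtain B where B: "finite B" "cspan B = Y" unfolding finite_cdim_def by blast
    have "z (2 * j) \<in> cspan B" for j
      unfolding B(2) using z by (auto simp: Y_def bi) presburger
    then show False
      using biorthogonal_not_in_finite_span[of "\<lambda>i. f (2 * i)" "\<lambda>j. z (2 * j)", OF f _ B(1)]
      by (simp add: bi)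
  qed
  moreover have "\<not> finite_ccodim Y"
  proof
    assume "finite_ccodim Y"
    then obtain B where B: "finite B" "\<And>x. \<exists>v\<in>cspan B. x - v \<in> Y"
      unfolding finite_ccodim_def by blast
    obtain v where v: "\<And>j. v j \<in> cspan B" "\<And>j. z (2 * j + 1) - v j \<in> Y"
      using B(2)[of "z (2 * _ + 1)"] by metis
    have "f (2 * i + 1) (v j) = f (2 * i + 1) (z (2 * j + 1))" for i j
      using v(2)[of j] cdual_diff[OF f, of "2 * i + 1" "z (2 * j + 1)" "v j"]
      by (auto simp: Y_def)
    then show False
      using biorthogonal_not_in_finite_span[of "\<lambda>i. f (2 * i + 1)" v, OF f _ B(1) v(1)]
      by (simp add: bi)
  qed
  ultimately have "halfspace Y" using sub by (simp add: halfspace_def)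
  then show ?thesis by (auto simp: Y_def)
qed

section \<open>Polynomials in an operator\<close>

abbreviation clinear :: "('a::complex_banach \<Rightarrow> 'a) \<Rightarrow> bool"
  where "clinear \<equiv> Vector_Spaces.linear scaleC scaleC"

lemma clinear_iff: "clinear T \<longleftrightarrow>
    (\<forall>x y. T (x + y) = T x + T y) \<and> (\<forall>c x. T (c *\<^sub>C x) = c *\<^sub>C T x)"
  using complex_vector.vector_space_axioms by (auto simp: Vector_Spaces.linear_iff)

lemma clinear_add: "clinear T \<Longrightarrow> T (x + y) = T x + T y"
  and clinear_scaleC: "clinear T \<Longrightarrow> T (c *\<^sub>C x) = c *\<^sub>C T x"
  by (simp_all add: clinear_iff)

lemma clinear_zero: "clinear T \<Longrightarrow> T 0 = 0"
  using clinear_add[of T 0 0] by simp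

lemma clinear_diff: "clinear T \<Longrightarrow> T (x - y) = T x - T y"
  using clinear_add[of T "x - y" y] by simp

lemma clinear_sum: "clinear T \<Longrightarrow> T (sum g A) = (\<Sum>i\<in>A. T (g i))"
  by (induction A rule: infinite_finite_induct) (simp_all add: clinear_zero clinear_add)

lemma finite_cdim_zero: "finite_cdim {0::'a::complex_banach}"
  unfolding finite_cdim_def by (rule exI[of _ "{}"]) simp

lemma csubspace_kernel:
  fixes B :: "'a::complex_banach \<Rightarrow> 'a"
  assumes "clinear B"
  shows "csubspace {x. B x = 0}"
  by (simp add: complex_vector.subspace_def clinear_zero[OF assms] clinear_add[OF assms]
      clinear_scaleC[OF assms])

text \<open>The image of the preimage \<open>V\<close> is a subspace of \<open>W\<close>, so it has a finite spanning set; lifts of its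
  members to \<open>V\<close>, together with a finite set that spans the kernel of \<open>B\<close>, span \<open>V\<close>.\<close>

lemma finite_cdim_vimage:
  fixes B :: "'a::complex_banach \<Rightarrow> 'a"
  assumes B: "clinear B" and W: "csubspace W" "finite_cdim W" and ker: "finite_cdim {x. B x = 0}"
  shows "finite_cdim {x. B x \<in> W}"
proof -
  define V where "V = {x. B x \<in> W}"
  have V: "csubspace V"
    using W(1) by (auto simp: V_def complex_vector.subspace_def
        clinear_add[OF B] clinear_scaleC[OF B] clinear_zero[OF B])
  have "csubspace (B ` V)"
    unfolding complex_vector.subspace_def
  proof (intro conjI ballI allI)
    show "0 \<in> B ` V"
      using complex_vector.subspace_0[OF V] clinear_zero[OF B] by (metis imageI)
    show "x + y \<in> B ` V" if "x \<in> B ` V" "y \<in> B ` V" for x y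
      using that complex_vector.subspace_add[OF V] clinear_add[OF B] by (smt (verit) imageE imageI)
    show "c *\<^sub>C x \<in> B ` V" if "x \<in> B ` V" for c x
      using that complex_vector.subspace_scale[OF V] clinear_scaleC[OF B] by (smt (verit) imageE imageI)
  qed
  moreover have "B ` V \<subseteq> W" by (auto simp: V_def)
  ultimately have "finite_cdim (B ` V)"
    using W(2) finite_cdim_iff[of "B ` V"] by (auto simp: finite_cdim_def)
  then obtain C where C: "finite C" "cspan C = B ` V" unfolding finite_cdim_def by blast
  then have "C \<subseteq> B ` V" using complex_vector.span_superset by blast
  then obtain C' where C': "C' \<subseteq> V" "finite C'" "C = B ` C'"
    using finite_subset_image[OF C(1)] by blast
  obtain D where D: "finite D" "cspan D = {x. B x = 0}" using ker unfolding finite_cdim_def by blast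
  have "V \<subseteq> cspan (C' \<union> D)"
  proof
    fix x assume "x \<in> V"
    then have "B x \<in> cspan C" using C(2) by blast
    then obtain u where "B x = (\<Sum>w\<in>C. u w *\<^sub>C w)"
      unfolding complex_vector.span_finite[OF C(1)] by blast
    moreover have "\<exists>y\<in>cspan C'. (\<Sum>w\<in>C. u w *\<^sub>C w) = B y"
    proof -
      define g where "g = inv_into C' B"
      have g: "g w \<in> C'" "B (g w) = w" if "w \<in> C" for w
        using that unfolding C'(3) g_def by (rule inv_into_into, rule f_inv_into_f)
      have "(\<Sum>w\<in>C. u w *\<^sub>C g w) \<in> cspan C'"
        using g by (intro complex_vector.span_sum complex_vector.span_scale complex_vector.span_base) auto
      moreover have "(\<Sum>w\<in>C. u w *\<^sub>C w) = B (\<Sum>w\<in>C. u w *\<^sub>C g w)"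
        using g by (simp add: clinear_sum[OF B] clinear_scaleC[OF B])
      ultimately show ?thesis by blast
    qed
    ultimately obtain y where y: "y \<in> cspan C'" "B x = B y" by auto
    then have "x - y \<in> cspan D" using D(2) by (simp add: clinear_diff[OF B])
    then have "y + (x - y) \<in> cspan (C' \<union> D)"
      using y(1) by (intro complex_vector.span_add)
        (auto intro: subsetD[OF complex_vector.span_mono])
    then show "x \<in> cspan (C' \<union> D)" by simp
  qed
  then show ?thesis
    using finite_cdim_iff[OF V] C'(2) D(1) unfolding V_def[symmetric] by blast
qed

text \<open>This is \<open>p(T)\<close> by Horner's scheme. The recursive call is made at \<open>T x\<close>, rather than applying
  \<open>T\<close> to its result, so that the recursion equation holds for maps \<open>T\<close> that need not send 0
  to 0.\<close>

definition poly_op :: "('a::complex_banach \<Rightarrow> 'a) \<Rightarrow> complex poly \<Rightarrow> 'a \<Rightarrow> 'a"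
  where "poly_op T p = fold_coeffs (\<lambda>a f x. a *\<^sub>C x + f (T x)) p (\<lambda>x. 0)"

lemma poly_op_0 [simp]: "poly_op T 0 x = 0"
  by (simp add: poly_op_def)

lemma poly_op_pCons [simp]: "poly_op T (pCons a p) x = a *\<^sub>C x + poly_op T p (T x)"
  by (cases "p = 0 \<and> a = 0") (auto simp: poly_op_def)

lemma poly_op_add [simp]: "poly_op T (p + q) x = poly_op T p x + poly_op T q x"
  by (induction p q arbitrary: x rule: poly_induct2) (simp_all add: scaleC_add_left algebra_simps)

lemma poly_op_smult [simp]: "poly_op T (smult c p) x = c *\<^sub>C poly_op T p x"
  by (induction p arbitrary: x) (simp_all add: scaleC_add_right scaleC_scaleC)

lemma poly_op_diff: "poly_op T (p - q) x = poly_op T p x - poly_op T q x"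
  using poly_op_add[of T "p - q" q x] by simp

lemma poly_op_sum: "poly_op T (sum p A) x = (\<Sum>i\<in>A. poly_op T (p i) x)"
  by (induction A rule: infinite_finite_induct) simp_all

lemma poly_op_monom: "poly_op T (monom c n) x = c *\<^sub>C (T ^^ n) x"
  by (induction n arbitrary: x) (simp_all add: monom_0 monom_Suc funpow_swap1)

lemma poly_op_linear_factor: "poly_op T [:- a, 1:] x = T x - a *\<^sub>C x"
  by simp

context
  fixes T :: "'a::complex_banach \<Rightarrow> 'a"
  assumes T: "clinear T"
begin

lemma clinear_poly_op: "clinear (poly_op T p)"
proof (induction p)
  case 0
  then show ?case by (simp add: clinear_iff)
next
  case (pCons a p)
  then show ?case
    using T by (simp add: clinear_iff scaleC_add_right scaleC_scaleC mult.commute)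
qed

lemma poly_op_commute: "poly_op T p (T x) = T (poly_op T p x)"
  by (induction p arbitrary: x) (simp_all add: clinear_add[OF T] clinear_scaleC[OF T] clinear_zero[OF T])

lemma poly_op_mult: "poly_op T (p * q) x = poly_op T p (poly_op T q x)"
  by (induction p arbitrary: x) (simp_all add: mult_pCons_left poly_op_commute)

lemma poly_op_mult_commute: "poly_op T p (poly_op T q x) = poly_op T q (poly_op T p x)"
  by (metis mult.commute poly_op_mult)

lemma poly_op_eigenvector:
  assumes "T v = a *\<^sub>C v"
  shows "poly_op T p v = poly p a *\<^sub>C v"
proof (induction p)
  case (pCons b p)
  have "poly_op T p (T v) = a *\<^sub>C poly p a *\<^sub>C v"
    using pCons.IH assms by (simp add: clinear_scaleC[OF clinear_poly_op])
  then show ?case by (simp add: scaleC_add_left scaleC_scaleC)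
qed simp

text \<open>Let \<open>p(T)\<close> annihilate a sum of eigenvectors, one for each eigenvalue in \<open>F\<close>. Multiplication by
  \<open>\<Prod>b\<in>F-{a}. (T - b)\<close> isolates the eigenvector for \<open>a\<close> and shows that \<open>p\<close> vanishes at \<open>a\<close>. So \<open>p\<close>
  has at least \<open>card F\<close> roots.\<close>

lemma card_eigenvalues_le:
  assumes deg: "\<And>e. \<exists>p. p \<noteq> 0 \<and> degree p \<le> N \<and> poly_op T p e = 0"
    and F: "finite F" "\<And>a. a \<in> F \<Longrightarrow> \<exists>v. v \<noteq> 0 \<and> T v = a *\<^sub>C v"
  shows "card F \<le> N"
proof -
  obtain v where v: "\<And>a. a \<in> F \<Longrightarrow> v a \<noteq> 0 \<and> T (v a) = a *\<^sub>C v a"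
    using F(2) by metis
  obtain p where p: "p \<noteq> 0" "degree p \<le> N" "poly_op T p (\<Sum>a\<in>F. v a) = 0"
    using deg by blast
  have "poly p a = 0" if a: "a \<in> F" for a
  proof -
    define q where "q = (\<Prod>b\<in>F - {a}. [:- b, 1:])"
    have qa: "poly q a \<noteq> 0"
      using F(1) by (simp add: q_def poly_prod)
    have qb: "poly q b = 0" if "b \<in> F" "b \<noteq> a" for b
      using F(1) that by (auto simp: q_def poly_prod)
    have "poly_op T q (\<Sum>a\<in>F. v a) = (\<Sum>b\<in>F. poly q b *\<^sub>C v b)"
      using v by (simp add: clinear_sum[OF clinear_poly_op] poly_op_eigenvector)
    also have "\<dots> = (\<Sum>b\<in>F. if b = a then poly q a *\<^sub>C v a else 0)"
      by (rule sum.cong) (auto simp: qb)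
    also have "\<dots> = poly q a *\<^sub>C v a"
      using F(1) a by simp
    finally have "poly_op T p (poly q a *\<^sub>C v a) = 0"
      using p(3) by (metis poly_op_mult_commute clinear_zero[OF clinear_poly_op])
    then have "(poly q a * poly p a) *\<^sub>C v a = 0"
      using v[OF a] by (simp add: clinear_scaleC[OF clinear_poly_op] poly_op_eigenvector scaleC_scaleC)
    then show ?thesis
      using qa v[OF a] by (simp add: complex_vector.scale_eq_0_iff)
  qed
  then have "card F \<le> card {a. poly p a = 0}"
    using poly_roots_finite[OF p(1)] by (intro card_mono) auto
  also have "\<dots> \<le> degree p" by (rule card_poly_roots_bound[OF p(1)])
  finally show ?thesis using p(2) by simp
qed

lemma finite_cdim_kernel_mult:
  assumes "finite_cdim {x. poly_op T p x = 0}" "finite_cdim {x. poly_op T q x = 0}"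
  shows "finite_cdim {x. poly_op T (p * q) x = 0}"
  using finite_cdim_vimage[OF clinear_poly_op csubspace_kernel[OF clinear_poly_op] assms]
  by (simp add: poly_op_mult)

lemma finite_cdim_kernel_one: "finite_cdim {x. poly_op T 1 x = 0}"
  using finite_cdim_zero by (simp add: one_pCons scaleC_one)

lemma finite_cdim_kernel_prod:
  assumes "\<And>i. i \<in> I \<Longrightarrow> finite_cdim {x. poly_op T (p i) x = 0}"
  shows "finite_cdim {x. poly_op T (prod p I) x = 0}"
  using assms
  by (induction I rule: infinite_finite_induct)
    (simp_all add: finite_cdim_kernel_mult finite_cdim_kernel_one)

text \<open>Induction on the degree: split off a root \<open>a\<close>, so \<open>p = (X - a) q\<close>. If \<open>q(T) e \<noteq> 0\<close>, then this
  vector is an eigenvector for \<open>a\<close>; hence \<open>X - a\<close> divides the product \<open>S\<close> over \<open>L\<close>, and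
  \<open>S\<^sup>n\<close> kills \<open>(T - a) e\<close> because \<open>q(T)\<close> does.\<close>

lemma killed_by_power_of_eigenvalue_product:
  assumes fin: "finite L" and L: "\<And>a v. T v = a *\<^sub>C v \<Longrightarrow> v \<noteq> 0 \<Longrightarrow> a \<in> L"
    and p: "p \<noteq> 0" "degree p \<le> n" "poly_op T p e = 0"
  shows "poly_op T ((\<Prod>a\<in>L. [:- a, 1:]) ^ n) e = 0"
  using p
proof (induction n arbitrary: p e)
  case 0
  then obtain c where "p = [:c:]" "c \<noteq> 0" by (metis degree_eq_zeroE le_zero_eq pCons_0_0)
  then have "e = 0" using 0 by (simp add: complex_vector.scale_eq_0_iff)
  then show ?case by (simp add: clinear_zero[OF clinear_poly_op])
next
  case (Suc n)
  define S where "S = (\<Prod>a\<in>L. [:- a, 1:])"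
  show ?case
  proof (cases "degree p = 0")
    case True
    then have "degree p \<le> n" by simp
    from Suc.IH[OF Suc.prems(1) this Suc.prems(3)]
    show ?thesis by (simp add: poly_op_mult clinear_zero[OF clinear_poly_op])
  next
    case False
    then have "\<not> constant (poly p)" by (simp add: constant_degree)
    then obtain a where "poly p a = 0" using fundamental_theorem_of_algebra by blast
    then obtain q where q: "p = [:- a, 1:] * q" by (metis poly_eq_0_iff_dvd dvdE)
    have "q \<noteq> 0" using Suc.prems(1) unfolding q by auto
    moreover from this have "degree p = Suc (degree q)"
      unfolding q by (subst degree_mult_eq) auto
    ultimately have q': "q \<noteq> 0" "degree q \<le> n" using Suc.prems(2) by auto
    have *: "T (poly_op T q e) = a *\<^sub>C poly_op T q e"
      using Suc.prems(3) unfolding q poly_op_mult by (simp only: poly_op_linear_factor) simp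
    show ?thesis
    proof (cases "poly_op T q e = 0")
      case True
      from Suc.IH[OF q' this] show ?thesis
        by (simp add: poly_op_mult clinear_zero[OF clinear_poly_op])
    next
      case False
      then have "a \<in> L" using L[OF *] by blast
      then have "[:- a, 1:] dvd S"
        unfolding S_def by (rule dvd_prodI[OF fin])
      then obtain R where "S = [:- a, 1:] * R" by (rule dvdE)
      then have R: "S = R * [:- a, 1:]" by (simp only: mult.commute)
      have "poly_op T q (poly_op T [:- a, 1:] e) = 0"
        using Suc.prems(3) unfolding q poly_op_mult by (metis poly_op_mult_commute)
      from Suc.IH[OF q' this]
      have "poly_op T (S ^ n) (poly_op T [:- a, 1:] e) = 0" by (simp only: S_def)
      then have "poly_op T (R * (S ^ n * [:- a, 1:])) e = 0"
        by (simp only: poly_op_mult clinear_zero[OF clinear_poly_op])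
      moreover have "R * (S ^ n * [:- a, 1:]) = S ^ Suc n"
        unfolding R by (simp only: power_Suc ac_simps)
      ultimately show ?thesis unfolding S_def by simp
    qed
  qed
qed

text \<open>If all eigenspaces were finite-dimensional, so would be the kernel of every product of factors
  \<open>T - a\<close>. But such a product vanishes on the whole space.\<close>

lemma exists_infinite_dimensional_eigenspace:
  assumes inf: "\<not> finite_cdim (UNIV :: 'a set)"
    and deg: "\<And>e. \<exists>p. p \<noteq> 0 \<and> degree p \<le> N \<and> poly_op T p e = 0"
  shows "\<exists>a. \<not> finite_cdim {x. T x = a *\<^sub>C x}"
proof (rule ccontr)
  assume "\<not> ?thesis"
  then have ker: "finite_cdim {x. poly_op T [:- a, 1:] x = 0}" for a
    by simp
  define L where "L = {a. \<exists>v. v \<noteq> 0 \<and> T v = a *\<^sub>C v}"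
  have "finite L"
  proof (rule ccontr)
    assume "infinite L"
    then obtain F where F: "F \<subseteq> L" "finite F" "card F = Suc N"
      using infinite_arbitrarily_large by blast
    then have "\<exists>v. v \<noteq> 0 \<and> T v = a *\<^sub>C v" if "a \<in> F" for a
      using that by (auto simp: L_def)
    from card_eigenvalues_le[OF deg F(2) this] show False using F(3) by simp
  qed
  have kill: "poly_op T ((\<Prod>a\<in>L. [:- a, 1:]) ^ N) e = 0" for e
  proof -
    obtain p where p: "p \<noteq> 0" "degree p \<le> N" "poly_op T p e = 0" using deg by blast
    have "a \<in> L" if "T v = a *\<^sub>C v" "v \<noteq> 0" for a v using that by (auto simp: L_def)
    from killed_by_power_of_eigenvalue_product[OF \<open>finite L\<close> this p] show ?thesis .
  qed
  have "finite_cdim {x. poly_op T (\<Prod>i<N. \<Prod>a\<in>L. [:- a, 1:]) x = 0}"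
    by (intro finite_cdim_kernel_prod ker)
  with kill have "finite_cdim (UNIV :: 'a set)" by simp
  with inf show False by contradiction
qed

end

section \<open>From local algebraicity to a uniform degree bound\<close>

text \<open>The tube lemma, in the form that projection along a compact factor is a closed map.\<close>

lemma closed_projection_compact:
  fixes K :: "'a::topological_space set" and G :: "('a \<times> 'b::topological_space) set"
  assumes "compact K" "closed G"
  shows "closed {y. \<exists>x\<in>K. (x, y) \<in> G}"
proof -
  have "closed_map (prod_topology (top_of_set K) euclidean) (euclidean :: 'b topology) snd"
    using assms(1) by (intro closed_map_snd) (simp add: compact_space_subtopology)
  moreover have "prod_topology (top_of_set K) (euclidean :: 'b topology) = top_of_set (K \<times> UNIV)"
    using prod_topology_subtopology(1)[of euclidean K "euclidean :: 'b topology"]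
    by simp
  moreover have "closedin (top_of_set (K \<times> UNIV)) ((K \<times> UNIV) \<inter> G)"
    using assms(2) by (rule closedin_closed_Int)
  ultimately have "closed (snd ` ((K \<times> UNIV) \<inter> G))"
    by (simp add: closed_map_def)
  moreover have "snd ` ((K \<times> UNIV) \<inter> G) = {y. \<exists>x\<in>K. (x, y) \<in> G}" by force
  ultimately show ?thesis by simp
qed

lemma compact_bounded_sequences:
  "compact {c :: nat \<Rightarrow> complex. \<forall>i. cmod (c i) \<le> r}"
proof -
  have "{c :: nat \<Rightarrow> complex. \<forall>i. cmod (c i) \<le> r} = (\<Pi>\<^sub>E i\<in>UNIV. cball 0 r)"
    by (auto simp: PiE_def Pi_def)
  moreover have "compactin (product_topology (\<lambda>i. euclidean) UNIV) (\<Pi>\<^sub>E i\<in>UNIV. cball (0::complex) r)"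
    unfolding compactin_PiE by simp
  ultimately show ?thesis
    by (simp add: euclidean_product_topology)
qed

text \<open>Bounding the coefficients makes the set a projection along a compact factor, hence closed: limits
  of vectors that satisfy such a recurrence satisfy one too.\<close>

lemma closed_bounded_recurrence:
  fixes T :: "'a::complex_banach \<Rightarrow> 'a"
  assumes T: "continuous_on UNIV T"
  shows "closed {e. \<exists>c. (\<forall>i. cmod (c i) \<le> r) \<and> (T ^^ n) e = (\<Sum>i<n. c i *\<^sub>C (T ^^ i) e)}"
proof -
  have pow: "continuous_on UNIV (T ^^ k)" for k
    by (induction k) (auto intro: continuous_on_compose2[OF T] simp: id_def)
  have coord: "continuous_on UNIV (\<lambda>p :: (nat \<Rightarrow> complex) \<times> 'a. fst p i)" for i
    by (rule continuous_on_product_then_coordinatewise[OF continuous_on_fst[OF continuous_on_id]])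
  have "closed {p :: (nat \<Rightarrow> complex) \<times> 'a. (T ^^ n) (snd p) = (\<Sum>i<n. fst p i *\<^sub>C (T ^^ i) (snd p))}"
    by (intro closed_Collect_eq continuous_intros coord continuous_on_compose2[OF pow]) auto
  from closed_projection_compact[OF compact_bounded_sequences this]
  show ?thesis by (simp add: Bex_def)
qed

text \<open>Otherwise the vectors \<open>(T ^^ i) e\<close> would be distinct and independent, infinitely many in a
  finitely generated space.\<close>

lemma finite_cdim_orbit_recurrence:
  fixes T :: "'a::complex_banach \<Rightarrow> 'a"
  assumes "finite B" "range (\<lambda>n. (T ^^ n) e) \<subseteq> cspan B"
  shows "\<exists>n c. (T ^^ n) e = (\<Sum>i<n. c i *\<^sub>C (T ^^ i) e)"
proof (rule ccontr)
  assume none: "\<not> ?thesis"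
  have notin: "(T ^^ n) e \<notin> cspan ((\<lambda>i. (T ^^ i) e) ` {..<n})" for n
  proof
    assume "(T ^^ n) e \<in> cspan ((\<lambda>i. (T ^^ i) e) ` {..<n})"
    moreover have "cspan ((\<lambda>i. (T ^^ i) e) ` {..<n}) \<subseteq> {\<Sum>i<n. c i *\<^sub>C (T ^^ i) e |c. True}"
    proof (rule complex_vector.span_minimal)
      show "(\<lambda>i. (T ^^ i) e) ` {..<n} \<subseteq> {\<Sum>i<n. c i *\<^sub>C (T ^^ i) e |c. True}"
      proof (rule image_subsetI)
        fix j assume "j \<in> {..<n}"
        then have "(T ^^ j) e = (\<Sum>i<n. (if i = j then 1 else 0) *\<^sub>C (T ^^ i) e)"
          by (simp add: if_distrib[of "\<lambda>c. c *\<^sub>C _"] scaleC_one cong: if_cong)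
        then show "(T ^^ j) e \<in> {\<Sum>i<n. c i *\<^sub>C (T ^^ i) e |c. True}"
          by (intro CollectI exI[of _ "\<lambda>i. if i = j then 1 else 0"]) simp
      qed
      show "csubspace {\<Sum>i<n. c i *\<^sub>C (T ^^ i) e |c. True}"
        unfolding complex_vector.subspace_def
      proof (safe, goal_cases)
        case 1
        show ?case by (rule exI[of _ "\<lambda>_. 0"]) simp
      next
        case (2 _ _ c d)
        show ?case by (rule exI[of _ "\<lambda>i. c i + d i"]) (simp add: scaleC_add_left sum.distrib)
      next
        case (3 a _ c)
        show ?case
          by (rule exI[of _ "\<lambda>i. a * c i"])
            (simp add: complex_vector.scale_sum_right scaleC_scaleC)
      qed
    qed
    ultimately show False using none by blast
  qed
  have "\<not> cdependent ((\<lambda>i. (T ^^ i) e) ` {..<n}) \<and> card ((\<lambda>i. (T ^^ i) e) ` {..<n}) = n" for n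
  proof (induction n)
    case (Suc n)
    let ?S = "(\<lambda>i. (T ^^ i) e) ` {..<n}"
    have new: "(T ^^ n) e \<notin> ?S"
      using notin[of n] complex_vector.span_base by metis
    have ins: "(\<lambda>i. (T ^^ i) e) ` {..<Suc n} = insert ((T ^^ n) e) ?S"
      by (simp only: lessThan_Suc image_insert)
    have "\<not> cdependent (insert ((T ^^ n) e) ?S)"
      using Suc notin[of n] new by (simp only: complex_vector.independent_insert) simp
    moreover have "card (insert ((T ^^ n) e) ?S) = Suc n"
      using card_insert_disjoint[OF finite_imageI[OF finite_lessThan] new] Suc by metis
    ultimately show ?case unfolding ins by blast
  qed (simp add: complex_vector.independent_empty)
  from this[of "Suc (card B)"] show False
    using complex_vector.independent_span_bound[OF assms(1), of "(\<lambda>i. (T ^^ i) e) ` {..<Suc (card B)}"]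
      assms(2) by auto
qed

text \<open>The sets \<open>A n r\<close> of vectors that satisfy a recurrence of length \<open>n\<close> with coefficients bounded by
  \<open>r\<close> are closed and cover the space, so one of them contains a ball by Baire's theorem. Each
  vector is a multiple of the difference of two points of this ball, and is annihilated by the
  product of two polynomials of degree at most \<open>n\<close>.\<close>

lemma uniform_degree_bound:
  fixes T :: "'a::complex_banach \<Rightarrow> 'a"
  assumes T: "clinear T" "continuous_on UNIV T"
    and loc: "\<And>e. \<exists>n c. (T ^^ n) e = (\<Sum>i<n. c i *\<^sub>C (T ^^ i) e)"
  shows "\<exists>N. \<forall>e. \<exists>p. p \<noteq> 0 \<and> degree p \<le> N \<and> poly_op T p e = 0"
proof -
  define A where "A n r = {e. \<exists>c. (\<forall>i. cmod (c i) \<le> real r) \<and> (T ^^ n) e = (\<Sum>i<n. c i *\<^sub>C (T ^^ i) e)}"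
    for n r :: nat
  have cover: "\<exists>n r. e \<in> A n r" for e
  proof -
    obtain n c where c: "(T ^^ n) e = (\<Sum>i<n. c i *\<^sub>C (T ^^ i) e)" using loc by blast
    obtain r :: nat where r: "(\<Sum>i<n. cmod (c i)) \<le> real r" using real_arch_simple by blast
    define d where "d i = (if i < n then c i else 0)" for i
    have "cmod (d i) \<le> real r" for i
      using r member_le_sum[of i "{..<n}" "\<lambda>i. cmod (c i)"] by (auto simp: d_def)
    moreover have "(T ^^ n) e = (\<Sum>i<n. d i *\<^sub>C (T ^^ i) e)"
      using c by (simp add: d_def)
    ultimately show ?thesis unfolding A_def by blast
  qed
  have "\<exists>n r. interior (A n r) \<noteq> {}"
  proof (rule ccontr)
    assume none: "\<not> ?thesis"
    have "euclidean interior_of \<Union> (range (\<lambda>(n, r). A n r)) = {}"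
      by (rule Baire_category_alt)
        (use none closed_bounded_recurrence[OF T(2)]
          in \<open>auto simp: completely_metrizable_space_euclidean A_def\<close>)
    moreover have "\<Union> (range (\<lambda>(n, r). A n r)) = UNIV" using cover by auto
    ultimately show False by simp
  qed
  then obtain n r x where "x \<in> interior (A n r)" by blast
  then obtain d where d: "0 < d" "ball x d \<subseteq> A n r" by (meson mem_interior)
  have ann: "\<exists>p. p \<noteq> 0 \<and> degree p \<le> n \<and> poly_op T p e = 0" if "e \<in> A n r" for e
  proof -
    obtain c where c: "(T ^^ n) e = (\<Sum>i<n. c i *\<^sub>C (T ^^ i) e)" using \<open>e \<in> A n r\<close> by (auto simp: A_def)
    define p where "p = monom 1 n - (\<Sum>i<n. monom (c i) i)"
    have "coeff p n = 1" by (simp add: p_def coeff_sum)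
    then have "p \<noteq> 0" by auto
    moreover have "degree p \<le> n"
      unfolding p_def by (intro degree_diff_le degree_sum_le)
        (auto intro: degree_monom_le order_trans[OF degree_monom_le])
    moreover have "poly_op T p e = 0"
      using c by (simp add: p_def poly_op_diff poly_op_sum poly_op_monom scaleC_one)
    ultimately show ?thesis by blast
  qed
  have half: "d / (2 * s) * s = d / 2" if "s \<noteq> 0" for s
    using that by simp
  have "\<exists>p. p \<noteq> 0 \<and> degree p \<le> 2 * n \<and> poly_op T p e = 0" for e
  proof -
    \<comment> \<open>The added 1 avoids a division by zero when \<open>e = 0\<close>.\<close>
    define t where "t = d / (2 * (norm e + 1))"
    have t: "0 < t" using d(1) by (simp add: t_def add_nonneg_pos)
    have "norm e + 1 \<noteq> 0" using norm_ge_zero[of e] by linarith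
    then have "t * (norm e + 1) = d / 2" unfolding t_def by (rule half)
    then have "t * norm e < d" using t d(1) by (simp add: distrib_left)
    then have "x + t *\<^sub>R e \<in> A n r" using d(2) t by (auto simp: dist_norm)
    moreover have "x \<in> A n r" using d by auto
    ultimately obtain p q where p: "p \<noteq> 0" "degree p \<le> n" "poly_op T p x = 0"
      and q: "q \<noteq> 0" "degree q \<le> n" "poly_op T q (x + t *\<^sub>R e) = 0"
      using ann by meson
    have "poly_op T (p * q) (x + t *\<^sub>R e) = 0"
      using q(3) by (simp add: poly_op_mult[OF T(1)] clinear_zero[OF clinear_poly_op[OF T(1)]])
    moreover have "poly_op T (p * q) x = 0"
      using p(3) by (simp add: mult.commute[of p] poly_op_mult[OF T(1)] clinear_zero[OF clinear_poly_op[OF T(1)]])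
    ultimately have "t *\<^sub>R poly_op T (p * q) e = 0"
      by (simp add: clinear_add[OF clinear_poly_op[OF T(1)]] clinear_scaleC[OF clinear_poly_op[OF T(1)]]
          flip: scaleC_of_real)
    then have "poly_op T (p * q) e = 0" using t by simp
    moreover have "degree (p * q) \<le> 2 * n" using degree_mult_le[of p q] p(2) q(2) by simp
    ultimately show ?thesis using p(1) q(1) by (metis no_zero_divisors)
  qed
  then show ?thesis by blast
qed

section \<open>Invariant halfspaces\<close>

lemma invariant_imp_defect_le_1:
  fixes T :: "'a::complex_banach \<Rightarrow> 'a"
  assumes "T ` Y \<subseteq> Y"
  shows "almost_invariant T Y" "defect T Y \<le> 1"
proof -
  have "cdim {0 :: 'a} = 0"
    using complex_vector.dim_eq_card_independent[OF complex_vector.independent_empty]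
      complex_vector.dim_span[of "{} :: 'a set"] by (simp only: complex_vector.span_empty card.empty)
  moreover have "T ` Y \<subseteq> Y + {0}" using assms by simp
  ultimately have 0: "csubspace {0 :: 'a}" "finite_cdim {0 :: 'a}" "cdim {0 :: 'a} = 0" "T ` Y \<subseteq> Y + {0}"
    using finite_cdim_zero complex_vector.subspace_single_0 by blast+
  then show "almost_invariant T Y" unfolding almost_invariant_def by blast
  have "defect T Y \<le> 0"
    unfolding defect_def by (rule Least_le) (use 0 in blast)
  then show "defect T Y \<le> 1" by simp
qed

lemma csubspace_closure:
  fixes S :: "'a::complex_banach set"
  assumes "csubspace S"
  shows "csubspace (closure S)"
  unfolding complex_vector.subspace_def
proof (intro conjI ballI allI)
  show "0 \<in> closure S"
    using assms closure_subset by (auto simp: complex_vector.subspace_def)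
  show "x + y \<in> closure S" if "x \<in> closure S" "y \<in> closure S" for x y
  proof -
    have "(\<lambda>p. fst p + snd p) ` closure (S \<times> S) \<subseteq> closure S"
      by (rule image_closure_subset)
        (use assms closure_subset in \<open>force simp: complex_vector.subspace_def intro: continuous_intros\<close>)+
    then show ?thesis using that by (force simp: closure_Times)
  qed
  show "c *\<^sub>C x \<in> closure S" if "x \<in> closure S" for c x
  proof -
    have "scaleC c ` closure S \<subseteq> closure S"
      by (rule image_closure_subset)
        (use assms closure_subset in \<open>force simp: complex_vector.subspace_def intro: continuous_intros\<close>)+
    then show ?thesis using that by blast
  qed
qed

lemma closed_cspan_orbit_invariant:
  fixes T :: "'a::complex_banach \<Rightarrow> 'a"
  assumes T: "clinear T" "continuous_on UNIV T"
  shows "T ` closed_cspan (range (\<lambda>n. (T ^^ n) e)) \<subseteq> closed_cspan (range (\<lambda>n. (T ^^ n) e))"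
proof -
  define S where "S = cspan (range (\<lambda>n. (T ^^ n) e))"
  have "S \<subseteq> {x. T x \<in> S}"
    unfolding S_def
  proof (rule complex_vector.span_minimal)
    show "range (\<lambda>n. (T ^^ n) e) \<subseteq> {x. T x \<in> cspan (range (\<lambda>n. (T ^^ n) e))}"
    proof clarify
      fix n
      have "(T ^^ Suc n) e \<in> cspan (range (\<lambda>n. (T ^^ n) e))"
        by (intro complex_vector.span_base rangeI)
      then show "T ((T ^^ n) e) \<in> cspan (range (\<lambda>n. (T ^^ n) e))" by simp
    qed
    show "csubspace {x. T x \<in> cspan (range (\<lambda>n. (T ^^ n) e))}"
      by (auto simp: complex_vector.subspace_def clinear_zero[OF T(1)] clinear_add[OF T(1)]
          clinear_scaleC[OF T(1)]
          intro: complex_vector.span_zero complex_vector.span_add complex_vector.span_scale)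
  qed
  then have "T ` closure S \<subseteq> closure S"
    using closure_subset[of S]
    by (intro image_closure_subset continuous_on_subset[OF T(2)]) auto
  then show ?thesis by (simp add: closed_cspan_def S_def)
qed

theorem theorem3p1:
  fixes T :: "'a::complex_banach \<Rightarrow> 'a"
  assumes "\<not> finite_cdim (UNIV :: 'a set)"
    and "Vector_Spaces.linear scaleC scaleC T"
    and "continuous_on UNIV T"
    and "\<not> (\<exists>Y. halfspace Y \<and> almost_invariant T Y \<and> defect T Y \<le> 1)"
  shows "\<exists>e. finite_ccodim (closed_cspan (range (\<lambda>n. (T ^^ n) e)))"
proof (rule ccontr)
  assume none: "\<not> ?thesis"
  note T = assms(2,3)
  have no_inv: "\<not> halfspace Y" if "T ` Y \<subseteq> Y" for Y
    using assms(4) invariant_imp_defect_le_1[OF that] by blast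
  have "\<exists>n c. (T ^^ n) e = (\<Sum>i<n. c i *\<^sub>C (T ^^ i) e)" for e
  proof -
    define Y where "Y = closed_cspan (range (\<lambda>n. (T ^^ n) e))"
    have "csubspace Y" "closed Y"
      by (simp_all add: Y_def closed_cspan_def csubspace_closure complex_vector.subspace_span)
    moreover have "\<not> halfspace Y" "\<not> finite_ccodim Y"
      using no_inv[OF closed_cspan_orbit_invariant[OF T]] none by (auto simp: Y_def)
    ultimately have "finite_cdim Y" by (auto simp: halfspace_def)
    then obtain B where "finite B" "cspan B = Y" unfolding finite_cdim_def by blast
    moreover have "range (\<lambda>n. (T ^^ n) e) \<subseteq> Y"
      unfolding Y_def closed_cspan_def
      using complex_vector.span_superset closure_subset by (rule order_trans)
    ultimately show ?thesis using finite_cdim_orbit_recurrence[of B T e] by simp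
  qed
  then obtain N where "\<And>e. \<exists>p. p \<noteq> 0 \<and> degree p \<le> N \<and> poly_op T p e = 0"
    using uniform_degree_bound[OF T] by blast
  then obtain a where a: "\<not> finite_cdim {x. T x = a *\<^sub>C x}"
    using exists_infinite_dimensional_eigenspace[OF T(1) assms(1)] by blast
  define Z where "Z = {x. T x = a *\<^sub>C x}"
  have "csubspace Z"
    by (auto simp: Z_def complex_vector.subspace_def clinear_zero[OF T(1)] clinear_add[OF T(1)]
        clinear_scaleC[OF T(1)] scaleC_add_right scaleC_scaleC mult.commute)
  moreover have "closed Z"
    unfolding Z_def by (intro closed_Collect_eq continuous_intros T(2))
  ultimately obtain Y where Y: "Y \<subseteq> Z" "halfspace Y"
    using exists_halfspace_subset[of Z] a by (auto simp: Z_def)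
  then have "T ` Y \<subseteq> Y"
    by (auto simp: Z_def halfspace_def subset_iff complex_vector.subspace_scale)
  then show False using no_inv Y(2) by blast
qed

end
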